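(* Let $\alpha\ge\log3$ and let $f(z)=\sum_{k\ge0}\xi_ke^{-\alpha k^2}z^k$ be a Rademacher entire function. Then (for every realization of the signs $\xi_k\in\{\pm1\}$) the function $f$ has only real zeros.
   Context: Rademacher entire function here means that $(\xi_k)_{k\ge0}$ are independent random variables taking each of the values $\pm1$ with probability $1/2$; the result is deterministic, i.e. it does not depend on the values of the sequence $(\xi_k)$. *)

theory Defs
  imports "HOL-Complex_Analysis.Complex_Analysis" "HOL-Real_Asymp.Real_Asymp"
begin

definition is_sign_sequence :: "(nat \<Rightarrow> real) \<Rightarrow> bool" where
  "is_sign_sequence \<xi> \<longleftrightarrow> (\<forall>k. \<xi> k \<in> {-1, 1})"

(* For random signs (independent, each of +1 and -1 with probability 1/2) this is one realization
   of the Rademacher entire function; statements for all sign sequences hold for every realization. *)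
definition rademacher_entire :: "real \<Rightarrow> (nat \<Rightarrow> real) \<Rightarrow> complex \<Rightarrow> complex" where
  "rademacher_entire \<alpha> \<xi> z =
     (\<Sum>k. of_real (\<xi> k * exp (- \<alpha> * real k ^ 2)) * z ^ k)"

(* The series converges everywhere, so suminf above is the true sum. *)
lemma summable_rademacher_entire:
  assumes "\<alpha> > 0" and "is_sign_sequence \<xi>"
  shows "summable (\<lambda>k. of_real (\<xi> k * exp (- \<alpha> * real k ^ 2)) * (z::complex) ^ k)"
proof -
  have lim: "(\<lambda>k. exp (- \<alpha> * real k) * norm z) \<longlonglongrightarrow> 0"
    using assms(1) by real_asymp
  have "eventually (\<lambda>k. exp (- \<alpha> * real k) * norm z < 1/2) sequentially"
    using order_tendstoD(2)[OF lim, of "1/2"] by simp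
  then obtain N where N: "\<And>k. k \<ge> N \<Longrightarrow> exp (- \<alpha> * real k) * norm z < 1/2"
    by (auto simp: eventually_sequentially)
  have "norm (of_real (\<xi> k * exp (- \<alpha> * real k ^ 2)) * z ^ k) \<le> (1/2) ^ k" if "k \<ge> N" for k
  proof -
    have "\<bar>\<xi> k\<bar> = 1"
      using assms(2) by (auto simp: is_sign_sequence_def dest: spec[of _ k])
    moreover have "exp (- \<alpha> * real k ^ 2) = exp (- \<alpha> * real k) ^ k"
      by (simp add: exp_of_nat_mult[symmetric] power2_eq_square mult_ac)
    ultimately have "norm (of_real (\<xi> k * exp (- \<alpha> * real k ^ 2)) * z ^ k)
        = (exp (- \<alpha> * real k) * norm z) ^ k"
      by (simp add: norm_mult norm_power abs_mult power_mult_distrib)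
    also have "\<dots> \<le> (1/2) ^ k"
      using N[OF that] by (intro power_mono) auto
    finally show ?thesis .
  qed
  then show ?thesis
    by (intro summable_comparison_test[OF _ summable_geometric[of "1/2::real"]]) auto
qed

lemma holomorphic_rademacher_entire:
  assumes "\<alpha> > 0" and "is_sign_sequence \<xi>"
  shows "rademacher_entire \<alpha> \<xi> holomorphic_on UNIV"
proof -
  have "rademacher_entire \<alpha> \<xi> holomorphic_on ball 0 r" for r
    using summable_rademacher_entire[OF assms, THEN summable_sums]
    by (intro power_series_holomorphic[where a = "\<lambda>k. of_real (\<xi> k * exp (- \<alpha> * real k ^ 2))"])
      (simp add: rademacher_entire_def)
  then have "rademacher_entire \<alpha> \<xi> field_differentiable at z" for z
    by (rule holomorphic_on_imp_differentiable_at[of _ "ball 0 (norm z + 1)"]) auto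
  then show ?thesis
    by (simp add: holomorphic_on_def)
qed

end

theory Submission
  imports Defs
begin

text \<open>
  Put q = exp (-\<alpha>) \<le> 1/3.  If f(z) = 0, then Im (z^(-p) f(z)) = 0 for every p.  Since
  \<bar>Im z^n\<bar> \<le> \<bar>n\<bar> \<bar>z\<bar>^(n-1) \<bar>Im z\<bar>, the factor \<bar>Im z\<bar> splits off from every term of
  that series, and the p-th term disappears.  Now let m be the index of a term of f that is maximal
  at z up to a factor q, and let p be the neighbour of m whose term may compete with it: with the
  p-th term gone, the m-th one exceeds the sum of all the others unless Im z = 0.
\<close>

section \<open>Imaginary parts of powers of z, shifted by powers of the conjugate\<close>

lemma abs_Im_power_le: "\<bar>Im (z ^ n)\<bar> * norm z \<le> real n * norm z ^ n * \<bar>Im z\<bar>"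
proof (induction n)
  case (Suc n)
  have "\<bar>Im (z ^ Suc n)\<bar> \<le> \<bar>Re z * Im (z ^ n)\<bar> + \<bar>Im z * Re (z ^ n)\<bar>"
    by simp
  also have "\<dots> \<le> norm z * \<bar>Im (z ^ n)\<bar> + \<bar>Im z\<bar> * norm z ^ n"
    unfolding abs_mult using abs_Re_le_cmod[of z] abs_Re_le_cmod[of "z ^ n"]
    by (intro add_mono mult_mono) (auto simp: norm_power)
  finally have "\<bar>Im (z ^ Suc n)\<bar> * norm z
      \<le> (norm z * \<bar>Im (z ^ n)\<bar> + \<bar>Im z\<bar> * norm z ^ n) * norm z"
    by (intro mult_right_mono) auto
  also have "\<dots> \<le> norm z * (real n * norm z ^ n * \<bar>Im z\<bar>) + \<bar>Im z\<bar> * norm z ^ n * norm z"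
    using mult_left_mono[OF Suc.IH, of "norm z"] by (simp add: algebra_simps)
  also have "\<dots> = real (Suc n) * norm z ^ Suc n * \<bar>Im z\<bar>"
    by (simp add: algebra_simps)
  finally show ?case .
qed simp

text \<open>The common factor \<open>z ^ p * cnj z ^ p\<close> is real and nonnegative, so up to
  sign only the difference of the exponents matters for the imaginary part.\<close>

lemma Im_power_mult_cnj_add:
  "\<bar>Im (z ^ (p + n) * cnj z ^ p)\<bar> = norm z ^ (2 * p) * \<bar>Im (z ^ n)\<bar>"
  "\<bar>Im (z ^ p * cnj z ^ (p + n))\<bar> = norm z ^ (2 * p) * \<bar>Im (z ^ n)\<bar>"
proof -
  have "z ^ p * cnj z ^ p = of_real (norm z ^ (2 * p))"
    by (simp add: power_mult_distrib[symmetric] complex_norm_square[symmetric] power_mult)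
  then have "z ^ (p + n) * cnj z ^ p = of_real (norm z ^ (2 * p)) * z ^ n"
      "z ^ p * cnj z ^ (p + n) = of_real (norm z ^ (2 * p)) * cnj (z ^ n)"
    by (simp_all add: power_add mult_ac)
  then show "\<bar>Im (z ^ (p + n) * cnj z ^ p)\<bar> = norm z ^ (2 * p) * \<bar>Im (z ^ n)\<bar>"
      "\<bar>Im (z ^ p * cnj z ^ (p + n))\<bar> = norm z ^ (2 * p) * \<bar>Im (z ^ n)\<bar>"
    by (simp_all add: abs_mult del: of_real_power complex_cnj_power)
qed

text \<open>Here \<open>cnj z ^ p\<close> stands in for the p-th negative power of z: the two differ
  by a positive real factor when z is nonzero. The extra \<open>norm z\<close> on the left keeps an
  exponent n - 1, and hence truncated subtraction, out of the bound.\<close>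

lemma abs_Im_power_mult_cnj_le:
  "\<bar>Im (z ^ k * cnj z ^ p)\<bar> * norm z \<le> \<bar>real k - real p\<bar> * norm z ^ (k + p) * \<bar>Im z\<bar>"
proof (cases "p \<le> k")
  case True
  then obtain n where "k = p + n"
    by (auto simp: le_iff_add)
  then show ?thesis
    using mult_left_mono[OF abs_Im_power_le[of z n], of "norm z ^ (2 * p)"]
    unfolding \<open>k = p + n\<close> Im_power_mult_cnj_add by (simp add: power_add power_mult power2_eq_square power_mult_distrib mult_ac)
next
  case False
  then obtain n where "p = k + n"
    using le_iff_add by (metis nat_le_linear)
  then show ?thesis
    using mult_left_mono[OF abs_Im_power_le[of z n], of "norm z ^ (2 * k)"]
    unfolding \<open>p = k + n\<close> Im_power_mult_cnj_add by (simp add: power_add power_mult power2_eq_square power_mult_distrib mult_ac)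
qed

text \<open>The product is now a nonnegative real times z or \<open>cnj z\<close>. Equality is what
  later bounds the central term from below.\<close>

lemma abs_Im_power_mult_cnj_neighbour:
  assumes "k = Suc p \<or> p = Suc k"
  shows "\<bar>Im (z ^ k * cnj z ^ p)\<bar> * norm z = norm z ^ (k + p) * \<bar>Im z\<bar>"
  using assms
proof
  assume k: "k = Suc p"
  show ?thesis
    using Im_power_mult_cnj_add(1)[of z p 1] unfolding k by (simp add: power_add mult_2)
next
  assume p: "p = Suc k"
  show ?thesis
    using Im_power_mult_cnj_add(2)[of z k 1] unfolding p by (simp add: power_add mult_2)
qed

text \<open>The m-th term is minus the sum of all others: the tail is controlled by
  \<open>u\<close>, the finite head by \<open>v\<close>. Nonnegativity of \<open>v\<close> allows
  the head to be bounded by the full sum \<open>V\<close>.\<close>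

lemma abs_term_le_of_sums_zero:
  fixes c u v :: "nat \<Rightarrow> real"
  assumes c: "c sums 0" and u: "u sums U" and v: "v sums V"
    and v_nonneg: "\<And>j. 0 \<le> v j"
    and above: "\<And>j. \<bar>c (m + Suc j)\<bar> \<le> W * u j"
    and below: "\<And>j. j < m \<Longrightarrow> \<bar>c (m - Suc j)\<bar> \<le> W * v j"
    and "0 \<le> W"
  shows "\<bar>c m\<bar> \<le> W * (U + V)"
proof -
  have "(\<Sum>k<m. \<bar>c k\<bar>) = (\<Sum>j<m. \<bar>c (m - Suc j)\<bar>)"
    by (rule sum.nat_diff_reindex[symmetric])
  also have "\<dots> \<le> W * (\<Sum>j<m. v j)"
    unfolding sum_distrib_left using below by (intro sum_mono) auto
  also have "\<dots> \<le> W * V"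
    using sum_le_suminf[of v "{..<m}"] v v_nonneg \<open>0 \<le> W\<close>
    by (intro mult_left_mono) (auto simp: sums_iff)
  finally have head: "\<bar>\<Sum>k<m. c k\<bar> \<le> W * V"
    using sum_abs[of c "{..<m}"] by linarith
  have shifted: "(\<lambda>j. c (j + Suc m)) sums (0 - (\<Sum>k<Suc m. c k))"
    using c by (subst sums_iff_shift) simp
  have bound: "norm (c (j + Suc m)) \<le> W * u j" for j
    using above[of j] by (simp add: add_ac)
  have "norm (0 - (\<Sum>k<Suc m. c k)) \<le> W * U"
    by (rule norm_sums_le[OF shifted sums_mult[OF u] bound])
  then show ?thesis
    using head by (simp add: algebra_simps)
qed

section \<open>Geometric majorants on the two sides of the central term\<close>

locale small_base =
  fixes q :: real
  assumes q_pos: "0 < q" and q_le: "q \<le> 1/3"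
begin

text \<open>For k at distance j + 1 from m, the distance to the removed index p is j on the side of
  p (\<open>near\<close>) and j + 2 on the other side (\<open>far\<close>). The value 0 of
  \<open>near\<close> at j = 0 is the removed term. The sums 3/4 and 1/8 add up to 7/8, below
  1.\<close>

abbreviation far :: "nat \<Rightarrow> real" where "far j \<equiv> 2/3 * (1/9) ^ j"
abbreviation near :: "nat \<Rightarrow> real" where "near j \<equiv> if j = 0 then 0 else (1/9) ^ j"

lemma far_sums: "far sums (3/4)"
  using sums_mult[OF geometric_sums[of "1/9::real"], of "2/3"] by simp

lemma near_sums: "near sums (1/8)"
proof -
  have "(\<lambda>j. near (Suc j)) sums (1/9 * (9/8))"
    using sums_mult[OF geometric_sums[of "1/9::real"], of "1/9"] by simp
  then show ?thesis
    by (subst (asm) sums_Suc_iff) simp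
qed

lemma far_bound: "real (j + 2) * q ^ (Suc j)\<^sup>2 \<le> far j"
proof -
  \<comment> \<open>Of the exponent 3j + 1, the part 2j gives the ratio 1/9, the 1 gives the
    constant 1/3, and the remaining j absorbs the linear factor through j + 2 <= 2 * 3^j.\<close>
  have "3 * j + 1 \<le> (Suc j)\<^sup>2"
    by (cases j) (auto simp: power2_eq_square)
  then have "q ^ (Suc j)\<^sup>2 \<le> q ^ (3 * j + 1)"
    using q_pos q_le by (intro power_decreasing) auto
  also have "\<dots> \<le> (1/3) ^ (3 * j + 1)"
    using q_pos q_le by (intro power_mono) auto
  also have "\<dots> = 1/3 * (1/9) ^ j * (1/3) ^ j"
    by (simp add: power_add power_mult power_mult_distrib[symmetric] power3_eq_cube)
  finally have "real (j + 2) * q ^ (Suc j)\<^sup>2 \<le> real (j + 2) * (1/3 * (1/9) ^ j * (1/3) ^ j)"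
    by (rule mult_left_mono) simp
  also have "\<dots> \<le> (2 * 3 ^ j) * (1/3 * (1/9) ^ j * (1/3) ^ j)"
  proof (rule mult_right_mono)
    show "real (j + 2) \<le> 2 * 3 ^ j"
      by (induction j) auto
  qed simp
  also have "\<dots> = far j"
    by (simp add: power_divide)
  finally show ?thesis .
qed

lemma near_bound: "real j * q ^ (j * Suc j) \<le> near j"
proof (cases j)
  case (Suc i)
  \<comment> \<open>With j = i + 1, the exponent is 2j + i(i + 1); the spare i absorbs the factor j
    <= 3^i.\<close>
  have "q ^ (j * Suc j) \<le> q ^ (2 * j + i)"
    using q_pos q_le unfolding Suc by (intro power_decreasing) auto
  also have "\<dots> \<le> (1/3) ^ (2 * j + i)"
    using q_pos q_le by (intro power_mono) auto
  also have "\<dots> = (1/9) ^ j * (1/3) ^ i"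
    by (simp add: power_add power_mult power2_eq_square)
  finally have "real j * q ^ (j * Suc j) \<le> real j * ((1/9) ^ j * (1/3) ^ i)"
    by (rule mult_left_mono) simp
  also have "\<dots> \<le> 3 ^ i * ((1/9) ^ j * (1/3) ^ i)"
  proof (rule mult_right_mono)
    show "real j \<le> 3 ^ i"
      unfolding Suc by (induction i) auto
  qed simp
  also have "\<dots> = near j"
    using Suc by (simp add: power_divide)
  finally show ?thesis .
qed simp

section \<open>Moduli of the terms relative to a central one\<close>

definition wt :: "real \<Rightarrow> nat \<Rightarrow> real" where
  "wt \<rho> k = q ^ k\<^sup>2 * \<rho> ^ k"

text \<open>Completing the square around m leaves a single parameter t =
  \<open>\<rho> * q ^ (2 * m)\<close>: moving up multiplies by powers of t, moving down divides by
  them, and both cost q to the power l^2.\<close>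

lemma wt_above: "wt \<rho> (m + l) = wt \<rho> m * ((\<rho> * q ^ (2 * m)) ^ l * q ^ l\<^sup>2)"
proof -
  have "q ^ (m + l)\<^sup>2 = q ^ m\<^sup>2 * (q ^ (2 * m)) ^ l * q ^ l\<^sup>2"
    unfolding power_add[symmetric] power_mult[symmetric]
    by (rule arg_cong[where f = "(^) q"]) (simp add: power2_eq_square algebra_simps)
  then show ?thesis
    by (simp add: wt_def power_add power_mult_distrib)
qed

lemma wt_below:
  assumes "l \<le> m" and "0 < \<rho>"
  shows "wt \<rho> (m - l) = wt \<rho> m * (q ^ l\<^sup>2 / (\<rho> * q ^ (2 * m)) ^ l)"
proof -
  obtain k where m: "m = k + l"
    using assms(1) by (metis le_add_diff_inverse2)
  have "wt \<rho> k * (\<rho> * q ^ (2 * m)) ^ l = wt \<rho> m * q ^ l\<^sup>2"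
    by (simp add: wt_def m power2_eq_square power_add power_mult power_mult_distrib algebra_simps)
  then show ?thesis
    using assms(2) q_pos by (simp add: m field_simps)
qed

lemma wt_pos: "0 < \<rho> \<Longrightarrow> 0 < wt \<rho> k"
  using q_pos by (simp add: wt_def)

lemma q_power_split: "q ^ (Suc j)\<^sup>2 = q ^ (j * Suc j) * q ^ Suc j"
  unfolding power_add[symmetric]
  by (rule arg_cong[where f = "(^) q"]) (simp add: power2_eq_square)

text \<open>For t <= 1 the upper side is the harmless one, and p lies below m. The primed variants
  treat the side of p, where t may be off by a factor q in the bad direction.\<close>

lemma wt_above_le:
  assumes "0 < \<rho>" and "\<rho> * q ^ (2 * m) \<le> 1"
  shows "real (j + 2) * wt \<rho> (m + Suc j) \<le> wt \<rho> m * far j"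
proof -
  have "(\<rho> * q ^ (2 * m)) ^ Suc j * q ^ (Suc j)\<^sup>2 \<le> 1 * q ^ (Suc j)\<^sup>2"
    using assms q_pos by (intro mult_right_mono power_le_one) auto
  then have "real (j + 2) * ((\<rho> * q ^ (2 * m)) ^ Suc j * q ^ (Suc j)\<^sup>2) \<le> far j"
    using far_bound[of j] by (smt (verit) mult_left_mono of_nat_0_le_iff mult_1)
  then show ?thesis
    using mult_left_mono[OF _ less_imp_le[OF wt_pos[OF assms(1), of m]]]
    unfolding wt_above by (metis mult.left_commute)
qed

lemma wt_above_le':
  assumes "0 < \<rho>" and "\<rho> * q ^ (2 * m) * q \<le> 1"
  shows "real j * wt \<rho> (m + Suc j) \<le> wt \<rho> m * near j"
proof -
  have "(\<rho> * q ^ (2 * m)) ^ Suc j * q ^ (Suc j)\<^sup>2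
      = q ^ (j * Suc j) * (\<rho> * q ^ (2 * m) * q) ^ Suc j"
    unfolding q_power_split power_mult_distrib by (simp only: mult_ac)
  also have "\<dots> \<le> q ^ (j * Suc j) * 1"
    using assms q_pos by (intro mult_left_mono power_le_one) auto
  finally have "real j * ((\<rho> * q ^ (2 * m)) ^ Suc j * q ^ (Suc j)\<^sup>2) \<le> near j"
    using near_bound[of j] by (smt (verit) mult_left_mono of_nat_0_le_iff)
  then show ?thesis
    using mult_left_mono[OF _ less_imp_le[OF wt_pos[OF assms(1), of m]]]
    unfolding wt_above by (metis mult.left_commute)
qed

lemma wt_below_le:
  assumes "1 \<le> \<rho> * q ^ (2 * m)" and "0 < \<rho>" and "j < m"
  shows "real (j + 2) * wt \<rho> (m - Suc j) \<le> wt \<rho> m * far j"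
proof -
  have "q ^ (Suc j)\<^sup>2 / (\<rho> * q ^ (2 * m)) ^ Suc j \<le> q ^ (Suc j)\<^sup>2 / 1"
    using assms q_pos by (intro divide_left_mono one_le_power mult_pos_pos) auto
  then have "real (j + 2) * (q ^ (Suc j)\<^sup>2 / (\<rho> * q ^ (2 * m)) ^ Suc j) \<le> far j"
    using far_bound[of j] by (smt (verit) mult_left_mono of_nat_0_le_iff div_by_1)
  then show ?thesis
    using mult_left_mono[OF _ less_imp_le[OF wt_pos[OF assms(2), of m]]] wt_below[of "Suc j" m \<rho>] assms
    by (metis mult.left_commute Suc_leI)
qed

lemma wt_below_le':
  assumes "q \<le> \<rho> * q ^ (2 * m)" and "0 < \<rho>" and "j < m"
  shows "real j * wt \<rho> (m - Suc j) \<le> wt \<rho> m * near j"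
proof -
  have "q ^ (Suc j)\<^sup>2 / (\<rho> * q ^ (2 * m)) ^ Suc j \<le> q ^ (Suc j)\<^sup>2 / q ^ Suc j"
    using assms q_pos by (intro divide_left_mono power_mono mult_pos_pos zero_less_power) auto
  also have "\<dots> = q ^ (j * Suc j)"
    using q_pos unfolding q_power_split by simp
  finally have "real j * (q ^ (Suc j)\<^sup>2 / (\<rho> * q ^ (2 * m)) ^ Suc j) \<le> near j"
    using near_bound[of j] by (smt (verit) mult_left_mono of_nat_0_le_iff)
  then show ?thesis
    using mult_left_mono[OF _ less_imp_le[OF wt_pos[OF assms(2), of m]]] wt_below[of "Suc j" m \<rho>] assms
    by (metis mult.left_commute Suc_leI)
qed

text \<open>Raising m by one multiplies t by q^2, so t can be brought into the interval from q to
  1/q. At m = 0 there is no lower neighbour to remove, hence the last condition, which holds since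
  then t = \<open>\<rho>\<close>.\<close>

lemma exists_central_index:
  assumes "1 \<le> \<rho>"
  obtains m where "\<rho> * q ^ (2 * m) * q \<le> 1" "q \<le> \<rho> * q ^ (2 * m)"
    "m = 0 \<Longrightarrow> 1 \<le> \<rho> * q ^ (2 * m)"
proof -
  let ?P = "\<lambda>m. \<rho> * q ^ (2 * m) * q \<le> 1"
  have "(\<lambda>m. \<rho> * (q\<^sup>2) ^ m * q) \<longlonglongrightarrow> \<rho> * 0 * q"
    using q_pos q_le by (intro tendsto_intros LIMSEQ_power_zero) (simp add: abs_square_less_1)
  then have "eventually (\<lambda>m. \<rho> * (q\<^sup>2) ^ m * q < 1) sequentially"
    by (intro order_tendstoD(2)[where y = "\<rho> * 0 * q"]) auto
  then have "\<exists>m. ?P m"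
    by (auto simp: power_mult eventually_sequentially intro: less_imp_le)
  then have P: "?P (LEAST m. ?P m)"
    by (rule LeastI_ex)
  show ?thesis
  proof (rule that[OF P])
    show "q \<le> \<rho> * q ^ (2 * (LEAST m. ?P m))"
    proof (cases "LEAST m. ?P m")
      case 0
      then show ?thesis
        using assms q_le by simp
    next
      \<comment> \<open>Failure at the predecessor says that its parameter exceeds 1/q; one step
        multiplies it by q^2, so t is still above q.\<close>
      case (Suc n)
      then have "\<not> ?P n"
        using not_less_Least[of n ?P] by simp
      then have "1 * q \<le> \<rho> * q ^ (2 * n) * q * q"
        using q_pos by (intro mult_right_mono) auto
      then show ?thesis
        using Suc by (simp add: mult_ac)
    qed
  qed (use assms in simp)
qed

section \<open>Exclusion of nonreal zeros\<close>

lemma real_zero: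
  assumes \<xi>: "is_sign_sequence \<xi>"
    and zero: "(\<lambda>k. of_real (\<xi> k * q ^ k\<^sup>2) * z ^ k) sums 0"
  shows "Im z = 0"
proof (rule ccontr)
  assume "Im z \<noteq> 0"
  then have Im: "0 < \<bar>Im z\<bar>" and z: "0 < norm z"
    by auto
  have abs_\<xi>: "\<bar>\<xi> k\<bar> = 1" for k
    using \<xi> by (auto simp: is_sign_sequence_def dest: spec[of _ k])
  consider "norm z < 1" | "1 \<le> norm z"
    by linarith
  then show False
  proof cases
    \<comment> \<open>Inside the unit disc the constant term dominates outright, so real parts
      suffice and no term is removed.\<close>
    case 1
    define c where "c k = Re (of_real (\<xi> k * q ^ k\<^sup>2) * z ^ k)" for k
    have c: "c sums 0"
      using sums_Re[OF zero] unfolding c_def by simp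
    have c_le: "\<bar>c k\<bar> \<le> wt (norm z) k" for k
      using abs_Re_le_cmod[of "of_real (\<xi> k * q ^ k\<^sup>2) * z ^ k"] abs_\<xi>[of k] q_pos
      unfolding c_def wt_def by (simp add: norm_mult norm_power abs_mult)
    have "\<bar>c (0 + Suc j)\<bar> \<le> 1 * far j" for j
    proof -
      have "1 * wt (norm z) (0 + Suc j) \<le> real (j + 2) * wt (norm z) (0 + Suc j)"
        using wt_pos[OF z, of "0 + Suc j"] by (intro mult_right_mono) auto
      then show ?thesis
        using c_le[of "0 + Suc j"] wt_above_le[of "norm z" 0 j] z 1 by (simp add: wt_def)
    qed
    \<comment> \<open>No index lies below 0, so \<open>near_sums\<close> only fills the slot of the
      empty head.\<close>
    from abs_term_le_of_sums_zero[OF c far_sums near_sums _ this]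
    have "\<bar>c 0\<bar> \<le> 1 * (3/4 + 1/8)"
      by simp
    then show False
      using abs_\<xi>[of 0] by (simp add: c_def)
  next
    case 2
    then obtain m where m: "norm z * q ^ (2 * m) * q \<le> 1" "q \<le> norm z * q ^ (2 * m)"
      "m = 0 \<Longrightarrow> 1 \<le> norm z * q ^ (2 * m)"
      using exists_central_index by metis
    define c where
      "c p k = Im (of_real (\<xi> k * q ^ k\<^sup>2) * z ^ k * cnj z ^ p * of_real (norm z))" for p k
    have c: "c p sums 0" for p
      using sums_Im[OF sums_mult2[OF sums_mult2[OF zero, of "cnj z ^ p"], of "of_real (norm z)"]]
      unfolding c_def by (simp only: mult_zero_left zero_complex.sel)
    have c_eq: "\<bar>c p k\<bar> = q ^ k\<^sup>2 * (\<bar>Im (z ^ k * cnj z ^ p)\<bar> * norm z)" for p k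
    proof -
      have "c p k = Im (of_real (\<xi> k * q ^ k\<^sup>2 * norm z) * (z ^ k * cnj z ^ p))"
        unfolding c_def of_real_mult by (simp only: mult_ac)
      also have "\<dots> = \<xi> k * q ^ k\<^sup>2 * norm z * Im (z ^ k * cnj z ^ p)"
        by (simp only: times_complex.sel Re_complex_of_real Im_complex_of_real mult_zero_left add_0_right)
      finally have "\<bar>c p k\<bar> = \<bar>\<xi> k\<bar> * \<bar>q ^ k\<^sup>2\<bar> * \<bar>norm z\<bar> * \<bar>Im (z ^ k * cnj z ^ p)\<bar>"
        by (simp only: abs_mult)
      then show ?thesis
        using abs_\<xi>[of k] q_pos by (simp only: abs_of_pos zero_less_power abs_norm_cancel mult_ac mult_1)
    qed
    define W where "W p = norm z ^ p * \<bar>Im z\<bar>" for p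
    have W: "0 < W p" for p
      using Im z by (simp add: W_def)
    have c_le: "\<bar>c p k\<bar> \<le> \<bar>real k - real p\<bar> * wt (norm z) k * W p" for p k
      using mult_left_mono[OF abs_Im_power_mult_cnj_le[of z k p], of "q ^ k\<^sup>2"] q_pos
      by (simp add: c_eq wt_def W_def power_add mult_ac)
    have c_m: "\<bar>c p m\<bar> = wt (norm z) m * W p" if "m = Suc p \<or> p = Suc m" for p
      using abs_Im_power_mult_cnj_neighbour[OF that, of z]
      by (simp add: c_eq wt_def W_def power_add mult_ac)
    have scale: "\<bar>c p k\<bar> \<le> wt (norm z) m * W p * b"
      if "\<bar>real k - real p\<bar> = d" "d * wt (norm z) k \<le> wt (norm z) m * b" for p k d b
      using c_le[of p k] mult_right_mono[OF that(2) less_imp_le[OF W[of p]]] that(1)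
      by (simp add: mult_ac)
    \<comment> \<open>The m-th term has modulus exactly \<open>wt (norm z) m * W p\<close>, which is
      positive and so cannot be at most 7/8 of itself.\<close>
    have dominated: False
      if "\<bar>c p m\<bar> \<le> wt (norm z) m * W p * (7/8)" "m = Suc p \<or> p = Suc m" for p
      using that c_m[of p] W[of p] wt_pos[OF z, of m] by (simp add: mult_less_0_iff)
    show False
    \<comment> \<open>For t <= 1 the rival of the m-th term is the one below it, so p = m - 1; for t
      >= 1 it is the one above, so p = m + 1.\<close>
    proof (cases "norm z * q ^ (2 * m) \<le> 1 \<and> m \<noteq> 0")
      case True
      then obtain p where p: "m = Suc p"
        by (metis not0_implies_Suc)
      have "\<bar>c p m\<bar> \<le> wt (norm z) m * W p * (3/4 + 1/8)"
      proof (rule abs_term_le_of_sums_zero[OF c far_sums near_sums])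
        show "\<bar>c p (m + Suc j)\<bar> \<le> wt (norm z) m * W p * far j" for j
          using True by (intro scale[OF _ wt_above_le[OF z]]) (simp_all add: p)
        show "\<bar>c p (m - Suc j)\<bar> \<le> wt (norm z) m * W p * near j" if "j < m" for j
          using that p by (intro scale[OF _ wt_below_le'[OF m(2) z that]]) (auto simp: of_nat_diff)
      qed (use W[of p] wt_pos[OF z, of m] in auto)
      then show False
        using dominated[of p] p by simp
    next
      case False
      then have t: "1 \<le> norm z * q ^ (2 * m)"
        using m(3) by linarith
      have "\<bar>c (Suc m) m\<bar> \<le> wt (norm z) m * W (Suc m) * (1/8 + 3/4)"
      proof (rule abs_term_le_of_sums_zero[OF c near_sums far_sums])
        show "\<bar>c (Suc m) (m + Suc j)\<bar> \<le> wt (norm z) m * W (Suc m) * near j" for j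
          by (intro scale[OF _ wt_above_le'[OF z m(1)]]) simp
        show "\<bar>c (Suc m) (m - Suc j)\<bar> \<le> wt (norm z) m * W (Suc m) * far j" if "j < m" for j
          using that by (intro scale[OF _ wt_below_le[OF t z that]]) (auto simp: of_nat_diff)
      qed (use W[of "Suc m"] wt_pos[OF z, of m] in auto)
      then show False
        using dominated[of "Suc m"] by simp
    qed
  qed
qed

end

theorem theorem31:
  fixes \<alpha> :: real and \<xi> :: "nat \<Rightarrow> real"
  assumes "\<alpha> \<ge> ln 3"
    and "is_sign_sequence \<xi>"
  shows "\<forall>z::complex. rademacher_entire \<alpha> \<xi> z = 0 \<longrightarrow> z \<in> \<real>"
proof (intro allI impI)
  fix z :: complex
  assume zero: "rademacher_entire \<alpha> \<xi> z = 0"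
  have "(0::real) < ln 3"
    by simp
  then have "0 < \<alpha>"
    using assms(1) by linarith
  have "exp (- \<alpha>) \<le> exp (- ln 3)"
    using assms(1) by simp
  then interpret small_base "exp (- \<alpha>)"
    by unfold_locales (auto simp: exp_minus)
  have exp_eq: "exp (- \<alpha> * real k ^ 2) = exp (- \<alpha>) ^ k\<^sup>2" for k
    by (simp add: exp_of_nat_mult[symmetric] mult_ac)
  have "(\<lambda>k. of_real (\<xi> k * exp (- \<alpha> * real k ^ 2)) * z ^ k) sums 0"
    using summable_sums[OF summable_rademacher_entire[OF \<open>0 < \<alpha>\<close> assms(2), of z]] zero
    by (simp only: rademacher_entire_def)
  then have "Im z = 0"
    unfolding exp_eq by (rule real_zero[OF assms(2)])
  then show "z \<in> \<real>"
    by (simp add: complex_is_Real_iff)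
qed

end
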